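(* Let $\mathcal{X}=\overline{([-x_1,x_2],0)}$ with $x_1,x_2>0$ and $x_1>x_2$. For any $\mathcal{Y}=\overline{([-y_1,y_2],0)}$ with $y_1,y_2>0$, $\dfrac{x_1}{x_2}>\dfrac{y_2}{y_1}$, $\dfrac{x_1}{x_2}>\dfrac{y_1}{y_2}$, there is $\mathcal{Z}=\overline{([-z_1,z_2],0)}$ (with $[-z_1,z_2]\in\mathbb{IR}$) such that $\mathcal{Y}=\mathcal{X}\bullet\mathcal{Z}$.
   Context: $\mathbb{IR}$ is the set of intervals $[a,b]$ with real $a\le b$, with addition $[a,b]+[c,d]=[a+c,b+d]$; $0$ also denotes $[0,0]$. $\overline{\mathbb{IR}}$ is the quotient of $\mathbb{IR}\times\mathbb{IR}$ by $(x,y)\sim(z,t)\iff x+t=y+z$, the class of $(x,y)$ being $\overline{(x,y)}$, with $\overline{(x,y)}+\overline{(z,t)}=\overline{(x+z,y+t)}$; every element can be written $\overline{(K,0)}$ or $\overline{(0,K)}$ with $K\in\mathbb{IR}$. $\mathcal{A}_4$ is the algebra $\mathbb{R}^4$ with product $x\cdot y=(x_1y_1+x_4y_4,\;x_2y_2+x_3y_3,\;x_3y_2+x_2y_3,\;x_4y_1+x_1y_4)$. For $K=[a,b]\in\mathbb{IR}$, $\varphi(K)=(a,b,0,0)$ if $a,b\ge0$; $(0,b,-a,0)$ if $a\le 0\le b$; $(0,0,-a,-b)$ if $a,b\le 0$. Define $\overline{\varphi}:\overline{\mathbb{IR}}\to\mathcal{A}_4$ by $\overline{\varphi}(\overline{(K,0)})=\varphi(K)$,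 $\overline{\varphi}(\overline{(0,K)})=-\varphi(K)$. Let $\mathcal{R}$ be the equivalence relation on $\mathcal{A}_4$: $(x_1,x_2,x_3,x_4)\sim(y_1,y_2,y_3,y_4)\iff x_1-y_1=x_3-y_3$ and $x_2-y_2=x_4-y_4$; the composite of $\overline{\varphi}$ with the projection $\mathcal{A}_4\to\mathcal{A}_4/\mathcal{R}$ is a bijection, whose inverse is denoted $\psi:\mathcal{A}_4/\mathcal{R}\to\overline{\mathbb{IR}}$. Explicitly, with $u=x_1-x_3$, $v=x_2-x_4$, $\psi$ sends the class of $(x_1,x_2,x_3,x_4)$ to $\overline{([u,v],0)}$ if $u\le v$ and to $\overline{(0,[-u,-v])}$ if $u\ge v$. The product on $\overline{\mathbb{IR}}$ is $\mathcal{X}\bullet\mathcal{X}'=\psi$ of the class of $\overline{\varphi}(\mathcal{X})\cdot\overline{\varphi}(\mathcal{X}')$. *)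

theory Defs
  imports "HOL-Analysis.Analysis" "HOL-Library.Interval"
begin

text \<open>\<^term>\<open>Interval (a, b)\<close> is the abstraction map of the type of intervals, so it is
  meaningful only if \<open>a \<le> b\<close>.\<close>

abbreviation ivl :: "real \<Rightarrow> real \<Rightarrow> real interval"
  where "ivl a b \<equiv> Interval (a, b)"

lemma lower_ivl [simp]: "a \<le> b \<Longrightarrow> lower (ivl a b) = a"
  by (simp add: lower.rep_eq Interval_inverse)

lemma upper_ivl [simp]: "a \<le> b \<Longrightarrow> upper (ivl a b) = b"
  by (simp add: upper.rep_eq Interval_inverse)

definition irbar_rel :: "real interval \<times> real interval \<Rightarrow> real interval \<times> real interval \<Rightarrow> bool"
  where "irbar_rel = (\<lambda>(x, y) (z, t). x + t = y + z)"

lemma irbar_rel_iff: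
  "irbar_rel (x, y) (z, t) \<longleftrightarrow>
     lower x - lower y = lower z - lower t \<and> upper x - upper y = upper z - upper t"
  by (auto simp: irbar_rel_def interval_eq_iff)

quotient_type irbar = "real interval \<times> real interval" / irbar_rel
proof (rule equivpI)
  show "reflp irbar_rel"
    by (auto intro!: reflpI simp: irbar_rel_iff)
  show "symp irbar_rel"
    by (auto intro!: sympI simp: irbar_rel_iff)
  show "transp irbar_rel"
    by (auto intro!: transpI simp: irbar_rel_iff)
qed

abbreviation cls :: "real interval \<Rightarrow> real interval \<Rightarrow> irbar"
  where "cls x y \<equiv> abs_irbar (x, y)"

lemma cls_eq_iff:
  "cls x y = cls z t \<longleftrightarrow>
     lower x - lower y = lower z - lower t \<and> upper x - upper y = upper z - upper t"
  by (simp add: irbar.abs_eq_iff irbar_rel_iff)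

lemma irbar_cases:
  obtains (left) K where "X = cls K 0"
        | (right) K where "X = cls 0 K" and "lower K < upper K"
proof -
  obtain x y where X: "X = cls x y"
    by (metis Quotient_abs_rep[OF Quotient_irbar] surj_pair)
  let ?u = "lower x - lower y" and ?v = "upper x - upper y"
  show thesis
  proof (cases "?u \<le> ?v")
    case True
    then have "X = cls (ivl ?u ?v) 0"
      by (simp add: X cls_eq_iff)
    then show ?thesis
      by (rule left)
  next
    case False
    then have "X = cls 0 (ivl (- ?u) (- ?v))" "lower (ivl (- ?u) (- ?v)) < upper (ivl (- ?u) (- ?v))"
      by (simp_all add: X cls_eq_iff)
    then show ?thesis
      by (rule right)
  qed
qed


lemma vector_4 [simp]:
  "(vector [a, b, c, d] :: 'a::zero ^ 4) $ 1 = a"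
  "(vector [a, b, c, d] :: 'a::zero ^ 4) $ 2 = b"
  "(vector [a, b, c, d] :: 'a::zero ^ 4) $ 3 = c"
  "(vector [a, b, c, d] :: 'a::zero ^ 4) $ 4 = d"
  unfolding vector_def by simp_all

definition a4_times :: "real ^ 4 \<Rightarrow> real ^ 4 \<Rightarrow> real ^ 4"  (infixl \<open>\<cdot>\<^sub>4\<close> 70)
  where "x \<cdot>\<^sub>4 y =
    vector [x $ 1 * y $ 1 + x $ 4 * y $ 4,
            x $ 2 * y $ 2 + x $ 3 * y $ 3,
            x $ 3 * y $ 2 + x $ 2 * y $ 3,
            x $ 4 * y $ 1 + x $ 1 * y $ 4]"

definition a4_rel :: "real ^ 4 \<Rightarrow> real ^ 4 \<Rightarrow> bool"
  where "a4_rel x y \<longleftrightarrow> x $ 1 - y $ 1 = x $ 3 - y $ 3 \<and> x $ 2 - y $ 2 = x $ 4 - y $ 4"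

lemma a4_rel_iff: "a4_rel x y \<longleftrightarrow> x $ 1 - x $ 3 = y $ 1 - y $ 3 \<and> x $ 2 - x $ 4 = y $ 2 - y $ 4"
  by (auto simp: a4_rel_def)

quotient_type a4_quot = "real ^ 4" / a4_rel
proof (rule equivpI)
  show "reflp a4_rel"
    by (auto intro!: reflpI simp: a4_rel_iff)
  show "symp a4_rel"
    by (auto intro!: sympI simp: a4_rel_iff)
  show "transp a4_rel"
    by (auto intro!: transpI simp: a4_rel_iff)
qed


definition phi :: "real interval \<Rightarrow> real ^ 4"
  where "phi K = (let a = lower K; b = upper K in
    if 0 \<le> a \<and> 0 \<le> b then vector [a, b, 0, 0]
    else if a \<le> 0 \<and> 0 \<le> b then vector [0, b, - a, 0]
    else vector [0, 0, - a, - b])"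

text \<open>The three cases agree where they overlap.\<close>

lemma phi_ivl:
  assumes "a \<le> b"
  shows "0 \<le> a \<Longrightarrow> 0 \<le> b \<Longrightarrow> phi (ivl a b) = vector [a, b, 0, 0]"
    and "a \<le> 0 \<Longrightarrow> 0 \<le> b \<Longrightarrow> phi (ivl a b) = vector [0, b, - a, 0]"
    and "a \<le> 0 \<Longrightarrow> b \<le> 0 \<Longrightarrow> phi (ivl a b) = vector [0, 0, - a, - b]"
  using assms by (auto simp: phi_def Let_def)

text \<open>A class has both forms \<^term>\<open>cls K 0\<close> and \<^term>\<open>cls 0 L\<close> exactly when \<open>K\<close> is a
  single point \<open>c\<close> and \<open>L\<close> is the point \<open>- c\<close>.  Then \<^term>\<open>phi K\<close> and \<^term>\<open>- phi L\<close> are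
  equivalent under \<^const>\<open>a4_rel\<close> but differ for \<open>c \<noteq> 0\<close>; the form \<^term>\<open>cls K 0\<close> is given
  precedence.\<close>

definition phi_bar :: "irbar \<Rightarrow> real ^ 4"
  where "phi_bar X =
    (if \<exists>K. X = cls K 0 then phi (THE K. X = cls K 0) else - phi (THE K. X = cls 0 K))"

lemma phi_bar_left: "phi_bar (cls K 0) = phi K"
proof -
  have "(THE L. cls K 0 = cls L 0) = K"
    by (rule the_equality) (auto simp: cls_eq_iff interval_eq_iff)
  then show ?thesis
    by (auto simp: phi_bar_def)
qed

lemma phi_bar_right:
  assumes "lower K < upper K"
  shows "phi_bar (cls 0 K) = - phi K"
proof -
  have "(THE L. cls 0 K = cls 0 L) = K"
    by (rule the_equality) (auto simp: cls_eq_iff interval_eq_iff)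
  moreover have "\<nexists>L. cls 0 K = cls L 0"
  proof
    assume "\<exists>L. cls 0 K = cls L 0"
    then obtain L where "lower L = - lower K" "upper L = - upper K"
      by (auto simp: cls_eq_iff)
    then show False
      using assms lower_le_upper[of L] by simp
  qed
  ultimately show ?thesis
    by (simp add: phi_bar_def)
qed

definition psi :: "a4_quot \<Rightarrow> irbar"
  where "psi = inv (abs_a4_quot \<circ> phi_bar)"

lemma phi_diffs:
  "phi K $ 1 - phi K $ 3 = lower K" "phi K $ 2 - phi K $ 4 = upper K"
  using lower_le_upper[of K] by (auto simp: phi_def Let_def)

lemma phi_bar_diffs:
  "phi_bar (cls K L) $ 1 - phi_bar (cls K L) $ 3 = lower K - lower L"
  "phi_bar (cls K L) $ 2 - phi_bar (cls K L) $ 4 = upper K - upper L"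
proof -
  have "phi_bar (cls K L) $ 1 - phi_bar (cls K L) $ 3 = lower K - lower L \<and>
        phi_bar (cls K L) $ 2 - phi_bar (cls K L) $ 4 = upper K - upper L"
  proof (cases "cls K L" rule: irbar_cases)
    case (left M)
    then show ?thesis
      using phi_diffs[of M] by (simp add: phi_bar_left) (simp add: cls_eq_iff)
  next
    case (right M)
    then show ?thesis
      using phi_diffs[of M] by (simp add: phi_bar_right) (simp add: cls_eq_iff)
  qed
  then show "phi_bar (cls K L) $ 1 - phi_bar (cls K L) $ 3 = lower K - lower L"
    "phi_bar (cls K L) $ 2 - phi_bar (cls K L) $ 4 = upper K - upper L"
    by auto
qed

lemma abs_phi_bar:
  assumes "lower K - lower L = x $ 1 - x $ 3" "upper K - upper L = x $ 2 - x $ 4"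
  shows "abs_a4_quot (phi_bar (cls K L)) = abs_a4_quot x"
  using assms by (simp add: a4_quot.abs_eq_iff a4_rel_iff phi_bar_diffs)

lemma bij_abs_phi_bar: "bij (abs_a4_quot \<circ> phi_bar)"
proof (rule bijI)
  show "inj (abs_a4_quot \<circ> phi_bar)"
  proof (rule injI)
    fix X Y assume eq: "(abs_a4_quot \<circ> phi_bar) X = (abs_a4_quot \<circ> phi_bar) Y"
    obtain K L M N where XY: "X = cls K L" "Y = cls M N"
      by (metis Quotient_abs_rep[OF Quotient_irbar] surj_pair)
    show "X = Y"
      using eq by (simp add: XY a4_quot.abs_eq_iff a4_rel_iff phi_bar_diffs cls_eq_iff)
  qed
  show "surj (abs_a4_quot \<circ> phi_bar)"
  proof (rule surjI)
    fix q
    define x where "x = rep_a4_quot q"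
    define K where "K = ivl (x $ 1 - x $ 3) (max (x $ 1 - x $ 3) (x $ 2 - x $ 4))"
    define L where "L = ivl 0 (max 0 ((x $ 1 - x $ 3) - (x $ 2 - x $ 4)))"
    have "abs_a4_quot (phi_bar (cls K L)) = abs_a4_quot x"
      by (rule abs_phi_bar) (auto simp: K_def L_def)
    then show "(abs_a4_quot \<circ> phi_bar) (SOME X. (abs_a4_quot \<circ> phi_bar) X = q) = q"
      by (intro someI[of "\<lambda>X. (abs_a4_quot \<circ> phi_bar) X = q"])
        (simp add: x_def Quotient_abs_rep[OF Quotient_a4_quot])
  qed
qed

lemma psi_abs:
  fixes x :: "real ^ 4"
  defines "u \<equiv> x $ 1 - x $ 3" and "v \<equiv> x $ 2 - x $ 4"
  shows "u \<le> v \<Longrightarrow> psi (abs_a4_quot x) = cls (ivl u v) 0"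
    and "v \<le> u \<Longrightarrow> psi (abs_a4_quot x) = cls 0 (ivl (- u) (- v))"
  unfolding psi_def
  by (rule inv_f_eq[OF bij_is_inj[OF bij_abs_phi_bar]]; simp add: u_def v_def abs_phi_bar)+

definition irbar_times :: "irbar \<Rightarrow> irbar \<Rightarrow> irbar"  (infixl \<open>\<bullet>\<^sub>I\<close> 70)
  where "X \<bullet>\<^sub>I Y = psi (abs_a4_quot (phi_bar X \<cdot>\<^sub>4 phi_bar Y))"

end

theory Submission
  imports Defs
begin

text \<open>On intervals containing \<open>0\<close> the product is linear in the endpoints of the right factor, so
  \<open>Z\<close> is the solution of a linear system with determinant \<open>x\<^sub>1\<^sup>2 - x\<^sub>2\<^sup>2\<close>, obtained by Cramer's
  rule; the two ratio conditions say that its coordinates are positive, which places the solution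
  in the region where the linear formula is valid.\<close>

text \<open>Both images under \<open>phi\<close> have the shape \<open>(0, b, - a, 0)\<close>, which
  \<open>a4_times\<close> preserves; the signs give \<open>u \<le> 0 \<le> v\<close>, hence the
  first branch of \<open>psi\<close>.\<close>

lemma irbar_times_zero_straddling:
  assumes "0 \<le> x1" "0 \<le> x2" "0 \<le> z1" "0 \<le> z2"
  shows "cls (ivl (- x1) x2) 0 \<bullet>\<^sub>I cls (ivl (- z1) z2) 0 =
    cls (ivl (- (x1 * z2 + x2 * z1)) (x1 * z1 + x2 * z2)) 0"
proof -
  have "0 \<le> x1 * z2 + x2 * z1" "0 \<le> x2 * z2 + x1 * z1"
    using assms by simp_all
  then have "- (x1 * z2 + x2 * z1) \<le> x2 * z2 + x1 * z1"
    by linarith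
  then show ?thesis
    using assms psi_abs(1)[of "vector [0, x2 * z2 + x1 * z1, x1 * z2 + x2 * z1, 0]"]
    by (simp add: irbar_times_def phi_bar_left phi_ivl(2) a4_times_def add.commute)
qed

theorem proposition23:
  fixes x1 x2 :: real and X :: irbar
  assumes "X = cls (ivl (- x1) x2) 0"
    and "x1 > 0" and "x2 > 0" and "x1 > x2"
  shows "\<forall>(y1::real) (y2::real) (Y::irbar).
    Y = cls (ivl (- y1) y2) 0 \<and> y1 > 0 \<and> y2 > 0 \<and> x1 / x2 > y2 / y1 \<and> x1 / x2 > y1 / y2 \<longrightarrow>
    (\<exists>(z1::real) (z2::real) (Z::irbar).
      - z1 \<le> z2 \<and> Z = cls (ivl (- z1) z2) 0 \<and> Y = X \<bullet>\<^sub>I Z)"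
proof (intro allI impI, elim conjE)
  fix y1 y2 :: real and Y :: irbar
  assume Y: "Y = cls (ivl (- y1) y2) 0" and y: "y1 > 0" "y2 > 0"
    and ratio: "x1 / x2 > y2 / y1" "x1 / x2 > y1 / y2"
  define d where "d = x1 * x1 - x2 * x2"
  define z1 where "z1 = (x1 * y2 - x2 * y1) / d"
  define z2 where "z2 = (x1 * y1 - x2 * y2) / d"
  have d: "d > 0"
    using assms(2-4) by (simp add: d_def mult_strict_mono)
  \<comment> \<open>The bounds act crosswise: the first in \<open>ratio\<close> makes the numerator
    of \<open>z2\<close> positive, the second that of \<open>z1\<close>.\<close>
  have "x2 * y1 < x1 * y2" "x2 * y2 < x1 * y1"
    using ratio y assms(3) by (simp_all add: field_simps)
  then have z: "z1 > 0" "z2 > 0"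
    using d by (simp_all add: z1_def z2_def)
  \<comment> \<open>Over the common denominator the mixed terms \<open>x1 * x2 * y2\<close> and
    \<open>x1 * x2 * y1\<close> cancel, leaving a multiple of \<open>d\<close>.\<close>
  have "x1 * z2 + x2 * z1 = (d * y1) / d" "x1 * z1 + x2 * z2 = (d * y2) / d"
    unfolding z1_def z2_def times_divide_eq_right add_divide_distrib[symmetric]
    by (simp_all add: d_def algebra_simps)
  then have "x1 * z2 + x2 * z1 = y1" "x1 * z1 + x2 * z2 = y2"
    using d by simp_all
  then have "Y = X \<bullet>\<^sub>I cls (ivl (- z1) z2) 0"
    using irbar_times_zero_straddling[of x1 x2 z1 z2] assms z Y by simp
  moreover have "- z1 \<le> z2"
    using z by simp
  ultimately show "\<exists>(z1::real) (z2::real) (Z::irbar).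
      - z1 \<le> z2 \<and> Z = cls (ivl (- z1) z2) 0 \<and> Y = X \<bullet>\<^sub>I Z"
    by blast
qed

end
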